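(* For every integer $n\ge 0$, the group $$G_n=\langle a,b,c,d \mid (a^{-1}b)^{10n}d^{-1}a^{2},\ b^{-2}c(b^{-1}a)^{10n},\ (d^{-1}c)^{10n+3}c^{-1}bc^{-2},\ d^{2}a^{-1}d(c^{-1}d)^{10n+3}\rangle$$ (which is the fundamental group of the double branched cover $\Sigma(K_n)$ of $S^3$ along Kanenobu's knot $K_n=K_{-10n,10n+3}$) is not left-orderable.
   Context: A group $G$ is left-orderable if it is nontrivial and admits a total order $<$ on its elements that is left-invariant: $g<h$ implies $fg<fh$ for all $f,g,h\in G$. By convention the trivial group is not left-orderable. The presentation of $\pi_1(\Sigma(K_n))$ displayed in the claim is a computation of Greene and Watson, and $G_n$ is taken to be the group given by this presentation; the knot $K_n$ itself plays no further role in the statement. *)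

theory Defs
  imports "HOL-Algebra.Coset"
begin

text \<open>A letter \<open>(x, True)\<close> stands for the generator \<open>x\<close> and \<open>(x, False)\<close> for its formal inverse.
  The elements of the free group on the type \<open>'a\<close> are the classes of words modulo insertion and
  deletion of cancelling pairs of letters.\<close>

type_synonym 'a word = "('a \<times> bool) list"

inductive free_eq :: "'a word \<Rightarrow> 'a word \<Rightarrow> bool" where
  cancel: "free_eq (u @ [(x, s), (x, \<not> s)] @ v) (u @ v)"
| refl: "free_eq u u"
| sym: "free_eq u v \<Longrightarrow> free_eq v u"
| trans: "free_eq u v \<Longrightarrow> free_eq v w \<Longrightarrow> free_eq u w"

definition free_class :: "'a word \<Rightarrow> 'a word set" where
  "free_class u = {v. free_eq u v}"

definition free_group :: "'a word set monoid" where
  "free_group = \<lparr>carrier = range free_class,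
                 mult = (\<lambda>X Y. \<Union>u\<in>X. \<Union>v\<in>Y. free_class (u @ v)),
                 one = free_class []\<rparr>"

definition free_gen :: "'a \<Rightarrow> 'a word set" where
  "free_gen x = free_class [(x, True)]"

lemma free_class_eq_iff: "free_class u = free_class v \<longleftrightarrow> free_eq u v"
  unfolding free_class_def by (auto intro: free_eq.intros)

lemma free_eq_append_left: "free_eq u v \<Longrightarrow> free_eq (w @ u) (w @ v)"
proof (induction rule: free_eq.induct)
  case (cancel u x s v)
  show ?case using free_eq.cancel[of "w @ u" x s v] by simp
qed (auto intro: free_eq.intros)

lemma free_eq_append_right: "free_eq u v \<Longrightarrow> free_eq (u @ w) (v @ w)"
proof (induction rule: free_eq.induct)
  case (cancel u x s v)
  show ?case using free_eq.cancel[of u x s "v @ w"] by simp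
qed (auto intro: free_eq.intros)

lemma free_eq_append: "free_eq u u' \<Longrightarrow> free_eq v v' \<Longrightarrow> free_eq (u @ v) (u' @ v')"
  by (meson free_eq.trans free_eq_append_left free_eq_append_right)

lemma carrier_free_group: "carrier free_group = range free_class"
  by (simp add: free_group_def)

lemma one_free_group: "\<one>\<^bsub>free_group\<^esub> = free_class []"
  by (simp add: free_group_def)

lemma mult_free_group:
  "free_class u \<otimes>\<^bsub>free_group\<^esub> free_class v = free_class (u @ v)"
proof -
  have "free_class (u' @ v') = free_class (u @ v)"
    if "u' \<in> free_class u" "v' \<in> free_class v" for u' v'
    using that free_class_eq_iff free_eq_append free_eq.sym
    unfolding free_class_def by blast
  moreover have "u \<in> free_class u" "v \<in> free_class v"
    by (auto simp: free_class_def intro: free_eq.refl)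
  ultimately have "(\<Union>u'\<in>free_class u. \<Union>v'\<in>free_class v. free_class (u' @ v')) = free_class (u @ v)"
    by blast
  then show ?thesis by (simp add: free_group_def)
qed

lemma free_eq_inverse:
  "free_eq (rev (map (\<lambda>(x, s). (x, \<not> s)) u) @ u) []"
proof (induction u)
  case (Cons p u)
  obtain x s where p: "p = (x, s)" by (cases p)
  have "free_eq (rev (map (\<lambda>(x, s). (x, \<not> s)) u) @ [(x, \<not> s), (x, \<not> \<not> s)] @ u)
          (rev (map (\<lambda>(x, s). (x, \<not> s)) u) @ u)"
    by (rule free_eq.cancel)
  then show ?case using free_eq.trans[OF _ Cons.IH] p by simp
qed (simp add: free_eq.refl)

lemma group_free_group: "group free_group"
proof (rule groupI)
  fix X :: "'a word set"
  assume "X \<in> carrier free_group"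
  then obtain u where "X = free_class u" by (auto simp: carrier_free_group)
  then have "free_class (rev (map (\<lambda>(x, s). (x, \<not> s)) u)) \<otimes>\<^bsub>free_group\<^esub> X = \<one>\<^bsub>free_group\<^esub>"
    by (simp add: mult_free_group one_free_group free_class_eq_iff free_eq_inverse)
  then show "\<exists>Y\<in>carrier free_group. Y \<otimes>\<^bsub>free_group\<^esub> X = \<one>\<^bsub>free_group\<^esub>"
    by (auto simp: carrier_free_group)
qed (auto simp: carrier_free_group mult_free_group one_free_group)

lemma free_gen_closed: "free_gen x \<in> carrier free_group"
  by (simp add: free_gen_def carrier_free_group)

definition normal_closure :: "('a, 'm) monoid_scheme \<Rightarrow> 'a set \<Rightarrow> 'a set" where
  "normal_closure G R = \<Inter> {N. N \<lhd> G \<and> R \<subseteq> N}"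

lemma (in group) normal_normal_closure:
  assumes "R \<subseteq> carrier G"
  shows "normal_closure G R \<lhd> G"
proof -
  have "carrier G \<lhd> G"
    by (simp add: normal_inv_iff subgroup_self)
  then have ne: "{N. N \<lhd> G \<and> R \<subseteq> N} \<noteq> {}" using assms by blast
  have "subgroup (\<Inter> {N. N \<lhd> G \<and> R \<subseteq> N}) G"
    using ne by (intro subgroups_Inter) (auto dest: normal_imp_subgroup)
  moreover have "x \<otimes> h \<otimes> inv x \<in> \<Inter> {N. N \<lhd> G \<and> R \<subseteq> N}"
    if "x \<in> carrier G" "h \<in> \<Inter> {N. N \<lhd> G \<and> R \<subseteq> N}" for x h
    using that by (blast intro: normal.inv_op_closed2)
  ultimately show ?thesis
    unfolding normal_closure_def normal_inv_iff[of "\<Inter> _"] by (intro conjI ballI)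
qed

lemma subset_normal_closure: "R \<subseteq> normal_closure G R"
  by (auto simp: normal_closure_def)

definition presented_group :: "'a word set set \<Rightarrow> 'a word set set monoid" where
  "presented_group R = free_group Mod normal_closure free_group R"

lemma group_presented_group:
  assumes "R \<subseteq> carrier free_group"
  shows "group (presented_group R)"
  unfolding presented_group_def
  using normal.factorgroup_is_group group.normal_normal_closure[OF group_free_group assms] .

definition left_orderable :: "('a, 'm) monoid_scheme \<Rightarrow> bool" where
  "left_orderable G \<longleftrightarrow>
     carrier G \<noteq> {\<one>\<^bsub>G\<^esub>} \<and>
     (\<exists>r \<subseteq> carrier G \<times> carrier G.
        strict_linear_order_on (carrier G) r \<and>
        (\<forall>f\<in>carrier G. \<forall>g\<in>carrier G. \<forall>h\<in>carrier G.
           (g, h) \<in> r \<longrightarrow> (f \<otimes>\<^bsub>G\<^esub> g, f \<otimes>\<^bsub>G\<^esub> h) \<in> r))"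


text \<open>Greene and Watson's presentation of the fundamental group of the double branched cover of
  Kanenobu's knot with parameters \<open>-10n\<close> and \<open>10n + 3\<close>.\<close>

datatype generator = Gen_a | Gen_b | Gen_c | Gen_d

definition kanenobu_relators :: "nat \<Rightarrow> generator word set set" where
  "kanenobu_relators n =
    (let F = free_group;
         a = free_gen Gen_a; b = free_gen Gen_b; c = free_gen Gen_c; d = free_gen Gen_d
     in {(inv\<^bsub>F\<^esub> a \<otimes>\<^bsub>F\<^esub> b) [^]\<^bsub>F\<^esub> (10 * n) \<otimes>\<^bsub>F\<^esub> inv\<^bsub>F\<^esub> d \<otimes>\<^bsub>F\<^esub> a [^]\<^bsub>F\<^esub> (2::nat),
         b [^]\<^bsub>F\<^esub> (-2::int) \<otimes>\<^bsub>F\<^esub> c \<otimes>\<^bsub>F\<^esub> (inv\<^bsub>F\<^esub> b \<otimes>\<^bsub>F\<^esub> a) [^]\<^bsub>F\<^esub> (10 * n),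
         (inv\<^bsub>F\<^esub> d \<otimes>\<^bsub>F\<^esub> c) [^]\<^bsub>F\<^esub> (10 * n + 3) \<otimes>\<^bsub>F\<^esub> inv\<^bsub>F\<^esub> c \<otimes>\<^bsub>F\<^esub> b \<otimes>\<^bsub>F\<^esub> c [^]\<^bsub>F\<^esub> (-2::int),
         d [^]\<^bsub>F\<^esub> (2::nat) \<otimes>\<^bsub>F\<^esub> inv\<^bsub>F\<^esub> a \<otimes>\<^bsub>F\<^esub> d \<otimes>\<^bsub>F\<^esub> (inv\<^bsub>F\<^esub> c \<otimes>\<^bsub>F\<^esub> d) [^]\<^bsub>F\<^esub> (10 * n + 3)})"

definition kanenobu_group :: "nat \<Rightarrow> generator word set set monoid" where
  "kanenobu_group n = presented_group (kanenobu_relators n)"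

lemma kanenobu_relators_closed: "kanenobu_relators n \<subseteq> carrier free_group"
proof -
  interpret F: group "free_group :: generator word set monoid" by (rule group_free_group)
  show ?thesis
    by (simp add: kanenobu_relators_def Let_def free_gen_closed)
qed

lemma group_kanenobu_group: "group (kanenobu_group n)"
  unfolding kanenobu_group_def
  by (rule group_presented_group[OF kanenobu_relators_closed])

end

theory Submission
  imports Defs
begin

text \<open>Put \<open>u = a\<^sup>-\<^sup>1b\<close>, \<open>U = u\<^sup>m\<close> with \<open>m = 10n\<close>, and \<open>v = d\<^sup>-\<^sup>1c\<close>. The relations say that \<open>d = a\<^sup>2U\<close>,
  \<open>c = b\<^sup>2U\<close>, and that \<open>d\<^sup>2aU = c\<^sup>2bU\<close> is a power of \<open>v\<close>. A left order makes the group act on the chain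
  of its nonempty proper lower sets, without a global fixed point.
  If \<open>v\<close> fixes \<open>s\<close>, then \<open>t = Us\<close> satisfies \<open>a\<^sup>2t = b\<^sup>2t\<close> and
  \<open>Ua\<^sup>2Ua\<^sup>2Ua t = t = Ub\<^sup>2Ub\<^sup>2Ub t\<close>; comparing the positions of \<open>t\<close>, \<open>at\<close> and \<open>bt\<close> shows that \<open>a\<close> and \<open>b\<close>
  fix \<open>t\<close>, so \<open>t\<close> is a global fixed point.
  If \<open>v\<close> has no fixed point, then by the intermediate value property it moves all points in the same
  direction, say upwards. Then \<open>d < c\<close> and \<open>a\<^sup>2 < b\<^sup>2\<close> pointwise, so that \<open>d\<^sup>2a = c\<^sup>2b\<close> forces \<open>b < a\<close>
  pointwise and hence \<open>b\<^sup>2 < a\<^sup>2\<close>, a contradiction.\<close>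

section \<open>Order-preserving group actions on conditionally complete chains\<close>

text \<open>The chain is a subset \<open>D\<close> of a complete lattice, because the lower sets of
  the group form a chain inside the non-linear lattice of all sets. Suprema are those of the ambient
  lattice; they stay in \<open>D\<close> only for nonempty families with an upper bound in
  \<open>D\<close>.\<close>

locale chain_action = group G for G :: "('g, 'm) monoid_scheme" (structure) +
  fixes D :: "'x::complete_lattice set" and act :: "'g \<Rightarrow> 'x \<Rightarrow> 'x" (infixr "\<cdot>" 74)
  assumes act_closed [simp]: "g \<in> carrier G \<Longrightarrow> s \<in> D \<Longrightarrow> g \<cdot> s \<in> D"
    and act_one [simp]: "s \<in> D \<Longrightarrow> \<one> \<cdot> s = s"
    and act_mult: "g \<in> carrier G \<Longrightarrow> h \<in> carrier G \<Longrightarrow> s \<in> D \<Longrightarrow> (g \<otimes> h) \<cdot> s = g \<cdot> h \<cdot> s"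
    and act_mono: "g \<in> carrier G \<Longrightarrow> s \<in> D \<Longrightarrow> t \<in> D \<Longrightarrow> s \<le> t \<Longrightarrow> g \<cdot> s \<le> g \<cdot> t"
    and chain: "s \<in> D \<Longrightarrow> t \<in> D \<Longrightarrow> s \<le> t \<or> t \<le> s"
    and Sup_closed: "X \<subseteq> D \<Longrightarrow> X \<noteq> {} \<Longrightarrow> t \<in> D \<Longrightarrow> (\<And>x. x \<in> X \<Longrightarrow> x \<le> t) \<Longrightarrow> Sup X \<in> D"
begin

lemma act_inv_act [simp]: "g \<in> carrier G \<Longrightarrow> s \<in> D \<Longrightarrow> inv g \<cdot> g \<cdot> s = s"
  by (simp flip: act_mult)

lemma act_act_inv [simp]: "g \<in> carrier G \<Longrightarrow> s \<in> D \<Longrightarrow> g \<cdot> inv g \<cdot> s = s"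
  by (simp flip: act_mult)

lemma act_le_iff [simp]: "g \<in> carrier G \<Longrightarrow> s \<in> D \<Longrightarrow> t \<in> D \<Longrightarrow> g \<cdot> s \<le> g \<cdot> t \<longleftrightarrow> s \<le> t"
  by (metis act_closed act_inv_act act_mono inv_closed)

lemma act_less_iff [simp]: "g \<in> carrier G \<Longrightarrow> s \<in> D \<Longrightarrow> t \<in> D \<Longrightarrow> g \<cdot> s < g \<cdot> t \<longleftrightarrow> s < t"
  by (simp add: less_le_not_le)

lemma act_eq_iff [simp]: "g \<in> carrier G \<Longrightarrow> s \<in> D \<Longrightarrow> t \<in> D \<Longrightarrow> g \<cdot> s = g \<cdot> t \<longleftrightarrow> s = t"
  by (metis act_inv_act)

lemma not_le_iff: "s \<in> D \<Longrightarrow> t \<in> D \<Longrightarrow> \<not> s \<le> t \<longleftrightarrow> t < s"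
  using chain by (auto simp: less_le_not_le)

lemma linear_cases:
  assumes "s \<in> D" "t \<in> D"
  obtains "s < t" | "s = t" | "t < s"
  using chain[OF assms] by (auto simp: le_less)

lemma pow_act_ge:
  assumes g: "g \<in> carrier G" and s: "s \<in> D" and le: "s \<le> g \<cdot> s"
  shows "s \<le> g [^] (m::nat) \<cdot> s"
proof (induction m)
  case (Suc m)
  have "g [^] m \<cdot> s \<le> g [^] m \<cdot> g \<cdot> s" using assms by simp
  with Suc have "s \<le> g [^] m \<cdot> g \<cdot> s" by (rule order.trans)
  then show ?case using g s by (simp add: act_mult)
qed (use s in simp)

lemma pow_act_le:
  assumes g: "g \<in> carrier G" and s: "s \<in> D" and le: "g \<cdot> s \<le> s"
  shows "g [^] (m::nat) \<cdot> s \<le> s"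
proof (induction m)
  case (Suc m)
  have "g [^] m \<cdot> g \<cdot> s \<le> g [^] m \<cdot> s" using assms by simp
  from this Suc have "g [^] m \<cdot> g \<cdot> s \<le> s" by (rule order.trans)
  then show ?case using g s by (simp add: act_mult)
qed (use s in simp)

lemma pow_act_fixed:
  "g \<in> carrier G \<Longrightarrow> s \<in> D \<Longrightarrow> g \<cdot> s = s \<Longrightarrow> g [^] (m::nat) \<cdot> s = s"
  by (simp add: antisym pow_act_ge pow_act_le)

text \<open>Knaster-Tarski argument: let \<open>y\<close> be the supremum of the set
  \<open>X\<close> of points below \<open>t\<close> that \<open>g\<close> does not move down. Then
  \<open>y\<close> belongs to \<open>X\<close>, and \<open>X\<close> is closed under
  \<open>g\<close>, so \<open>g\<close> fixes \<open>y\<close>.\<close>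

lemma fixed_point_between:
  assumes g: "g \<in> carrier G" and s: "s \<in> D" and t: "t \<in> D"
    and st: "s \<le> t" and up: "s \<le> g \<cdot> s" and down: "g \<cdot> t \<le> t"
  shows "\<exists>y\<in>D. g \<cdot> y = y"
proof -
  define X where "X = {r \<in> D. r \<le> t \<and> r \<le> g \<cdot> r}"
  define y where "y = Sup X"
  have y: "y \<in> D"
    unfolding y_def using s st up by (intro Sup_closed[OF _ _ t]) (auto simp: X_def)
  have X: "g \<cdot> r \<in> X" if "r \<in> X" for r
  proof -
    have "g \<cdot> r \<le> g \<cdot> t" using that g t by (simp add: X_def)
    then show ?thesis using that g down by (auto simp: X_def)
  qed
  have "r \<le> g \<cdot> y" if "r \<in> X" for r
  proof -
    have "r \<le> y" using that by (simp add: y_def Sup_upper)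
    then have "g \<cdot> r \<le> g \<cdot> y" using that y g by (simp add: X_def)
    then show ?thesis using that by (auto simp: X_def)
  qed
  then have "y \<le> g \<cdot> y" by (simp add: y_def Sup_least)
  moreover have "y \<le> t" by (auto simp: y_def X_def intro: Sup_least)
  ultimately have "y \<in> X" using y by (simp add: X_def)
  then have "g \<cdot> y \<le> y" using X by (simp add: y_def Sup_upper)
  with \<open>y \<le> g \<cdot> y\<close> y show ?thesis by (metis order.antisym)
qed

text \<open>Intermediate value property. If the points occur in the opposite order, passing to
  \<open>inv g\<close> exchanges up and down and reduces to the previous lemma.\<close>

lemma fixed_point_if_sign_change:
  assumes g: "g \<in> carrier G" and s: "s \<in> D" and t: "t \<in> D"
    and up: "s \<le> g \<cdot> s" and down: "g \<cdot> t \<le> t"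
  shows "\<exists>y\<in>D. g \<cdot> y = y"
proof (cases "s \<le> t")
  case True
  then show ?thesis using fixed_point_between assms by blast
next
  case False
  have "inv g \<cdot> s \<le> s" "t \<le> inv g \<cdot> t"
    using act_mono[OF inv_closed[OF g] _ _ up] act_mono[OF inv_closed[OF g] _ _ down] g s t
    by simp_all
  moreover have "t \<le> s" using False chain s t by blast
  ultimately obtain y where "y \<in> D" "inv g \<cdot> y = y"
    using fixed_point_between[of "inv g" t s] g s t by auto
  then show ?thesis using g by (metis act_act_inv)
qed

section \<open>Comparing a and b at a single point\<close>

text \<open>The word is \<open>U \<cdot> g\<close> preceded by two blocks
  \<open>U \<cdot> g \<cdot> g\<close>. Each block keeps points above \<open>t\<close>: if
  \<open>t < s\<close>, then \<open>g \<cdot> s\<close> is above \<open>g \<cdot> t\<close>, hence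
  above \<open>t\<close>, and \<open>U \<cdot> g \<cdot> s'\<close> is above \<open>t\<close> for
  every \<open>s'\<close> above \<open>t\<close>.\<close>

lemma word_moves_up:
  assumes "g \<in> carrier G" "U \<in> carrier G" "t \<in> D" "t < g \<cdot> t" "t < U \<cdot> g \<cdot> t"
  shows "t < U \<cdot> g \<cdot> g \<cdot> U \<cdot> g \<cdot> g \<cdot> U \<cdot> g \<cdot> t"
proof -
  have step: "t < U \<cdot> g \<cdot> g \<cdot> s" if "s \<in> D" "t < s" for s
  proof -
    have "t < g \<cdot> s"
      using assms that by (metis act_less_iff order.strict_trans)
    then have "U \<cdot> g \<cdot> t < U \<cdot> g \<cdot> g \<cdot> s" using assms that by simp
    then show ?thesis using assms by (metis order.strict_trans)
  qed
  show ?thesis using assms by (intro step) simp_all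
qed

lemma word_moves_down:
  assumes "g \<in> carrier G" "U \<in> carrier G" "t \<in> D" "g \<cdot> t < t" "U \<cdot> g \<cdot> t < t"
  shows "U \<cdot> g \<cdot> g \<cdot> U \<cdot> g \<cdot> g \<cdot> U \<cdot> g \<cdot> t < t"
proof -
  have step: "U \<cdot> g \<cdot> g \<cdot> s < t" if "s \<in> D" "s < t" for s
  proof -
    have "g \<cdot> s < t"
      using assms that by (metis act_less_iff order.strict_trans)
    then have "U \<cdot> g \<cdot> g \<cdot> s < U \<cdot> g \<cdot> t" using assms that by simp
    then show ?thesis using assms by (metis order.strict_trans)
  qed
  show ?thesis using assms by (intro step) simp_all
qed

text \<open>As \<open>U\<close> is a power of \<open>inv a \<otimes> b\<close>, it moves a point
  \<open>s\<close> weakly in the direction from \<open>a \<cdot> s\<close> to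
  \<open>b \<cdot> s\<close>. If \<open>t\<close> were moved, the word in whichever of
  \<open>a\<close>, \<open>b\<close> moves it less would move \<open>t\<close> as well, against
  \<open>wa\<close> or \<open>wb\<close>.\<close>

lemma fixed_by_both:
  fixes m :: nat
  assumes a: "a \<in> carrier G" and b: "b \<in> carrier G" and t: "t \<in> D"
    and U: "U = (inv a \<otimes> b) [^] m"
    and sq: "a \<cdot> a \<cdot> t = b \<cdot> b \<cdot> t"
    and wa: "U \<cdot> a \<cdot> a \<cdot> U \<cdot> a \<cdot> a \<cdot> U \<cdot> a \<cdot> t = t"
    and wb: "U \<cdot> b \<cdot> b \<cdot> U \<cdot> b \<cdot> b \<cdot> U \<cdot> b \<cdot> t = t"
  shows "a \<cdot> t = t \<and> b \<cdot> t = t"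
proof -
  have [simp]: "U \<in> carrier G" using a b U by simp
  note [simp] = a b t
  have U_ge: "s \<le> U \<cdot> s" if "s \<in> D" "a \<cdot> s \<le> b \<cdot> s" for s
  proof -
    have "inv a \<cdot> a \<cdot> s \<le> inv a \<cdot> b \<cdot> s" using that by (intro act_mono) simp_all
    then show ?thesis unfolding U using that by (intro pow_act_ge) (simp_all add: act_mult)
  qed
  have U_le: "U \<cdot> s \<le> s" if "s \<in> D" "b \<cdot> s \<le> a \<cdot> s" for s
  proof -
    have "inv a \<cdot> b \<cdot> s \<le> inv a \<cdot> a \<cdot> s" using that by (intro act_mono) simp_all
    then show ?thesis unfolding U using that by (intro pow_act_le) (simp_all add: act_mult)
  qed
  have a_up: False if "t < a \<cdot> t" "a \<cdot> t \<le> b \<cdot> t"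
  proof -
    have "t \<le> U \<cdot> t" using U_ge that by simp
    also have "\<dots> < U \<cdot> a \<cdot> t" using that by simp
    finally show False using word_moves_up[of a U t] that wa by simp
  qed
  have a_down: False if "a \<cdot> t < t" "b \<cdot> t \<le> a \<cdot> t"
  proof -
    have "U \<cdot> a \<cdot> t < U \<cdot> t" using that by simp
    also have "\<dots> \<le> t" using U_le that by simp
    finally show False using word_moves_down[of a U t] that wa by simp
  qed
  \<comment> \<open>At \<open>t\<close> itself \<open>U\<close> now moves in the unhelpful
    direction, so \<open>U\<close> is evaluated at \<open>b \<cdot> t\<close>. There
    \<open>sq\<close> reverses the comparison: \<open>b \<cdot> b \<cdot> t = a \<cdot> a \<cdot> t
    \<le> a \<cdot> b \<cdot> t\<close>.\<close>
  have b_down: False if "b \<cdot> t < t" "a \<cdot> t < b \<cdot> t"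
  proof -
    have "b \<cdot> b \<cdot> t \<le> a \<cdot> b \<cdot> t" using that by (simp flip: sq add: less_imp_le)
    then have "U \<cdot> b \<cdot> t \<le> b \<cdot> t" by (intro U_le) simp_all
    also have "\<dots> < t" by (rule that)
    finally show False using word_moves_down[of b U t] that wb by simp
  qed
  have b_up: False if "t < b \<cdot> t" "b \<cdot> t < a \<cdot> t"
  proof -
    have "a \<cdot> b \<cdot> t \<le> b \<cdot> b \<cdot> t" using that by (simp flip: sq add: less_imp_le)
    then have "b \<cdot> t \<le> U \<cdot> b \<cdot> t" by (intro U_ge) simp_all
    with that have "t < U \<cdot> b \<cdot> t" by (auto intro: order.strict_trans2)
    then show False using word_moves_up[of b U t] that wb by simp
  qed
  have sq_up: "t < g \<cdot> g \<cdot> t" if "g \<in> carrier G" "t < g \<cdot> t" for g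
    using that by (metis act_less_iff act_closed order.strict_trans t)
  have sq_down: "g \<cdot> g \<cdot> t < t" if "g \<in> carrier G" "g \<cdot> t < t" for g
    using that by (metis act_less_iff act_closed order.strict_trans t)
  have D: "a \<cdot> t \<in> D" "b \<cdot> t \<in> D" by simp_all
  show ?thesis
  \<comment> \<open>By \<open>sq\<close>, the squares of \<open>a\<close> and \<open>b\<close> send
    \<open>t\<close> to the same point, so \<open>a\<close> and \<open>b\<close> move
    \<open>t\<close> in the same direction or both fix it.\<close>
  proof (cases rule: linear_cases[OF D(1) t])
    case 1
    with sq sq_down[OF a] have "b \<cdot> b \<cdot> t < t" by simp
    then have "b \<cdot> t < t"
      using sq_up[OF b] by (cases rule: linear_cases[OF D(2) t]) auto
    with 1 a_down b_down show ?thesis by (cases rule: linear_cases[OF D]) (auto dest: less_imp_le)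
  next
    case 2
    then have "b \<cdot> b \<cdot> t = t" using sq by simp
    then show ?thesis
      using 2 sq_up[OF b] sq_down[OF b] by (cases rule: linear_cases[OF D(2) t]) auto
  next
    case 3
    with sq sq_up[OF a] have "t < b \<cdot> b \<cdot> t" by simp
    then have "t < b \<cdot> t"
      using sq_down[OF b] by (cases rule: linear_cases[OF D(2) t]) auto
    with 3 a_up b_up show ?thesis by (cases rule: linear_cases[OF D]) (auto dest: less_imp_le)
  qed
qed

section \<open>Global fixed points from the Kanenobu relations\<close>

text \<open>A point with \<open>a \<cdot> s \<le> b \<cdot> s\<close> would make
  \<open>d \<cdot> d \<cdot> a \<cdot> s\<close> strictly smaller than
  \<open>c \<cdot> c \<cdot> b \<cdot> s\<close>. Hence b lies below a everywhere, and squaring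
  contradicts \<open>sq\<close>. Exchanging a with b and c with d turns this into the case where v
  moves points down.\<close>

lemma pointwise_contradiction:
  assumes [simp]: "a \<in> carrier G" "b \<in> carrier G" "c \<in> carrier G" "d \<in> carrier G"
    and t: "t \<in> D"
    and dc: "\<And>s. s \<in> D \<Longrightarrow> d \<cdot> s < c \<cdot> s"
    and sq: "\<And>s. s \<in> D \<Longrightarrow> a \<cdot> a \<cdot> s < b \<cdot> b \<cdot> s"
    and eq: "\<And>s. s \<in> D \<Longrightarrow> c \<cdot> c \<cdot> b \<cdot> s = d \<cdot> d \<cdot> a \<cdot> s"
  shows False
proof -
  have ba: "b \<cdot> s < a \<cdot> s" if [simp]: "s \<in> D" for s
  proof (rule ccontr)
    assume "\<not> b \<cdot> s < a \<cdot> s"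
    then have "a \<cdot> s \<le> b \<cdot> s" using not_le_iff[of "a \<cdot> s" "b \<cdot> s"] by simp
    then have "d \<cdot> d \<cdot> a \<cdot> s \<le> d \<cdot> d \<cdot> b \<cdot> s" by simp
    also have "\<dots> < d \<cdot> c \<cdot> b \<cdot> s" using dc by simp
    also have "\<dots> < c \<cdot> c \<cdot> b \<cdot> s" using dc by simp
    finally show False using eq by simp
  qed
  have "b \<cdot> b \<cdot> t < b \<cdot> a \<cdot> t" using ba t by simp
  also have "\<dots> < a \<cdot> a \<cdot> t" using ba t by simp
  finally show False using sq[OF t] by simp
qed

lemma kanenobu_fixed_point:
  fixes m k :: nat
  assumes ne: "D \<noteq> {}"
    and [simp]: "a \<in> carrier G" "b \<in> carrier G" "c \<in> carrier G" "d \<in> carrier G"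
    and U: "U = (inv a \<otimes> b) [^] m"
    and d: "d = a \<otimes> a \<otimes> U" and c: "c = b \<otimes> b \<otimes> U"
    and vc: "(inv d \<otimes> c) [^] k = c \<otimes> c \<otimes> inv b \<otimes> c"
    and vd: "(inv d \<otimes> c) [^] k = d \<otimes> d \<otimes> inv a \<otimes> d"
  shows "\<exists>t\<in>D. a \<cdot> t = t \<and> b \<cdot> t = t \<and> c \<cdot> t = t \<and> d \<cdot> t = t"
proof -
  have UG [simp]: "U \<in> carrier G" by (simp add: U)
  define v where "v = inv d \<otimes> c"
  have vG [simp]: "v \<in> carrier G" by (simp add: v_def)
  have d_act: "d \<cdot> s = a \<cdot> a \<cdot> U \<cdot> s" and c_act: "c \<cdot> s = b \<cdot> b \<cdot> U \<cdot> s" if "s \<in> D" for s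
    using that by (simp_all add: c d act_mult)
  have dv: "d \<cdot> v \<cdot> s = c \<cdot> s" if "s \<in> D" for s
    using that by (simp add: v_def act_mult)
  \<comment> \<open>Substituting c = bbU for the last factor cancels \<open>inv b\<close>, so that
    v^k = ccbU; likewise v^k = ddaU.\<close>
  have vc_act: "v [^] k \<cdot> s = c \<cdot> c \<cdot> b \<cdot> U \<cdot> s" if "s \<in> D" for s
    unfolding v_def vc using that by (simp add: act_mult c_act)
  have vd_act: "v [^] k \<cdot> s = d \<cdot> d \<cdot> a \<cdot> U \<cdot> s" if "s \<in> D" for s
    unfolding v_def vd using that by (simp add: act_mult d_act)
  show ?thesis
  proof (cases "\<exists>s\<in>D. v \<cdot> s = s")
    case True
    then obtain s where s [simp]: "s \<in> D" and vs: "v \<cdot> s = s" by blast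
    have vks: "v [^] k \<cdot> s = s" using vs by (simp add: pow_act_fixed)
    \<comment> \<open>The words ccbU and ddaU fix \<open>s\<close>, so their conjugates Uccb and
      Udda fix \<open>U \<cdot> s\<close>. Expanding c and d there gives the words of
      \<open>fixed_by_both\<close>.\<close>
    define t where "t = U \<cdot> s"
    have t [simp]: "t \<in> D" by (simp add: t_def)
    have "a \<cdot> a \<cdot> t = b \<cdot> b \<cdot> t"
      using dv[of s] vs by (simp add: c_act d_act t_def)
    moreover have "U \<cdot> d \<cdot> d \<cdot> a \<cdot> t = t" "U \<cdot> c \<cdot> c \<cdot> b \<cdot> t = t"
      using vc_act[OF s] vd_act[OF s] vks by (simp_all add: t_def)
    ultimately have fixed: "a \<cdot> t = t" "b \<cdot> t = t"
      using fixed_by_both[of a b t U m] U by (simp_all add: c_act d_act)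
    then have "(inv a \<otimes> b) \<cdot> t = t"
      using act_inv_act[of a t] by (simp add: act_mult)
    then have "U \<cdot> t = t" unfolding U by (simp add: pow_act_fixed)
    with fixed show ?thesis by (intro bexI[of _ t]) (simp_all add: c_act d_act)
  next
    case False
    have eq: "c \<cdot> c \<cdot> b \<cdot> s = d \<cdot> d \<cdot> a \<cdot> s" if "s \<in> D" for s
      using vc_act[of "inv U \<cdot> s"] vd_act[of "inv U \<cdot> s"] that by simp
    from ne obtain s where s: "s \<in> D" by blast
    \<comment> \<open>Two points moved in opposite directions would produce a fixed point of
      \<open>v\<close>.\<close>
    have "(\<forall>s\<in>D. s < v \<cdot> s) \<or> (\<forall>s\<in>D. v \<cdot> s < s)"
      using False fixed_point_if_sign_change[OF vG] not_le_iff
      by (metis act_closed order.order_iff_strict vG)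
    then show ?thesis
    proof
      assume up: "\<forall>s\<in>D. s < v \<cdot> s"
      have dc: "d \<cdot> s < c \<cdot> s" if "s \<in> D" for s
        using that up by (simp flip: dv)
      have sq: "a \<cdot> a \<cdot> s < b \<cdot> b \<cdot> s" if "s \<in> D" for s
        using dc[of "inv U \<cdot> s"] that by (simp add: c_act d_act)
      show ?thesis using pointwise_contradiction[of a b c d s] s dc sq eq by simp
    next
      assume down: "\<forall>s\<in>D. v \<cdot> s < s"
      have cd: "c \<cdot> s < d \<cdot> s" if "s \<in> D" for s
        using that down by (simp flip: dv)
      have sq: "b \<cdot> b \<cdot> s < a \<cdot> a \<cdot> s" if "s \<in> D" for s
        using cd[of "inv U \<cdot> s"] that by (simp add: c_act d_act)
      show ?thesis using pointwise_contradiction[of b a d c s] s cd sq eq by simp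
    qed
  qed
qed

end

section \<open>Left-ordered groups acting on their lower sets\<close>

text \<open>This chain takes the place of the real line in the dynamical realization of a left
  order. The empty set and the whole group are excluded because every translation fixes
  them.\<close>

definition proper_lower_sets :: "('a, 'm) monoid_scheme \<Rightarrow> ('a \<times> 'a) set \<Rightarrow> 'a set set" where
  "proper_lower_sets G r =
     {S. S \<subset> carrier G \<and> S \<noteq> {} \<and> (\<forall>x\<in>S. \<forall>z. (z, x) \<in> r \<longrightarrow> z \<in> S)}"

lemma (in group) l_coset_mono: "S \<subseteq> T \<Longrightarrow> g <# S \<subseteq> g <# T"
  by (auto simp: l_coset_def)

text \<open>Left invariance makes translates of lower sets lower sets, and totality makes lower sets
  comparable. A union of lower sets bounded by a proper one is again proper.\<close>

lemma (in group) chain_action_lower_sets: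
  assumes r: "r \<subseteq> carrier G \<times> carrier G" and lin: "strict_linear_order_on (carrier G) r"
    and inv: "\<And>f g h. f \<in> carrier G \<Longrightarrow> g \<in> carrier G \<Longrightarrow> h \<in> carrier G \<Longrightarrow>
      (g, h) \<in> r \<Longrightarrow> (f \<otimes> g, f \<otimes> h) \<in> r"
  shows "chain_action G (proper_lower_sets G r) (l_coset G)"
proof (unfold_locales, goal_cases)
  case (1 g S)
  then have g: "g \<in> carrier G" and S: "S \<subseteq> carrier G" "S \<noteq> carrier G" "S \<noteq> {}"
    and low: "\<And>x z. x \<in> S \<Longrightarrow> (z, x) \<in> r \<Longrightarrow> z \<in> S"
    by (auto simp: proper_lower_sets_def)
  have "g <# S \<noteq> carrier G"
  proof
    assume eq: "g <# S = carrier G"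
    have "S = inv g <# (g <# S)" using g S by (simp add: lcos_m_assoc lcos_mult_one)
    also have "\<dots> = carrier G"
      unfolding eq using g by (simp add: coset_join3 subgroup_self)
    finally show False using S by simp
  qed
  moreover have "g <# S \<subseteq> carrier G" using g S by (simp add: l_coset_subset_G)
  moreover have "g <# S \<noteq> {}" using S by (auto simp: l_coset_def)
  moreover have "z \<in> g <# S" if "x \<in> g <# S" "(z, x) \<in> r" for x z
  proof -
    from that(1) obtain h where h: "h \<in> S" "x = g \<otimes> h" by (auto simp: l_coset_def)
    have z: "z \<in> carrier G" and x: "x \<in> carrier G" using that(2) r by auto
    have "(inv g \<otimes> z, inv g \<otimes> x) \<in> r" using inv that(2) g x z by simp
    moreover have "inv g \<otimes> x = h" using h g S by (auto simp: m_assoc[symmetric])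
    ultimately have "inv g \<otimes> z \<in> S" using low h by simp
    moreover have "z = g \<otimes> (inv g \<otimes> z)" using g z by (simp add: m_assoc[symmetric])
    ultimately show ?thesis unfolding l_coset_def by blast
  qed
  ultimately show ?case by (auto simp: proper_lower_sets_def)
next
  case (2 S)
  then show ?case by (auto simp: proper_lower_sets_def lcos_mult_one)
next
  case (3 g h S)
  then have "S \<subseteq> carrier G" by (auto simp: proper_lower_sets_def)
  with 3 show ?case by (simp add: lcos_m_assoc)
next
  case (4 g S T)
  then show ?case by (simp add: l_coset_mono)
next
  case (5 S T)
  show ?case
  proof (rule disjCI)
    assume "\<not> T \<subseteq> S"
    then obtain t where t: "t \<in> T" "t \<notin> S" by blast
    show "S \<subseteq> T"
    proof
      fix s assume s: "s \<in> S"
      have "s \<in> carrier G" "t \<in> carrier G" "s \<noteq> t" "(t, s) \<notin> r"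
        using 5 s t unfolding proper_lower_sets_def by blast+
      then have "(s, t) \<in> r"
        using lin by (auto simp: strict_linear_order_on_def total_on_def)
      then show "s \<in> T" using 5 t unfolding proper_lower_sets_def by blast
    qed
  qed
next
  case (6 X T)
  then have "\<Union> X \<subseteq> T" by blast
  then have "\<Union> X \<subset> carrier G" using 6(3) by (auto simp: proper_lower_sets_def)
  moreover have "\<Union> X \<noteq> {}" using 6(1,2) by (fastforce simp: proper_lower_sets_def)
  moreover have "z \<in> \<Union> X" if "x \<in> \<Union> X" "(z, x) \<in> r" for x z
    using that 6(1) unfolding proper_lower_sets_def by blast
  ultimately show ?case by (simp add: proper_lower_sets_def)
qed

text \<open>The relations force a lower set fixed by the generators, hence by the whole group. This
  is impossible, since left translation is transitive on elements and so moves some element of the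
  set out of it.\<close>

lemma (in group) not_left_orderable_if_kanenobu_relations:
  fixes m k :: nat
  assumes abcd: "a \<in> carrier G" "b \<in> carrier G" "c \<in> carrier G" "d \<in> carrier G"
    and gen: "\<And>H. subgroup H G \<Longrightarrow> {a, b, c, d} \<subseteq> H \<Longrightarrow> carrier G \<subseteq> H"
    and r1: "(inv a \<otimes> b) [^] m \<otimes> inv d \<otimes> a [^] (2::nat) = \<one>"
    and r2: "b [^] (-2::int) \<otimes> c \<otimes> (inv b \<otimes> a) [^] m = \<one>"
    and r3: "(inv d \<otimes> c) [^] k \<otimes> inv c \<otimes> b \<otimes> c [^] (-2::int) = \<one>"
    and r4: "d [^] (2::nat) \<otimes> inv a \<otimes> d \<otimes> (inv c \<otimes> d) [^] k = \<one>"
  shows "\<not> left_orderable G"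
proof
  note [simp] = abcd
  assume "left_orderable G"
  then obtain r where nontriv: "carrier G \<noteq> {\<one>}" and r: "r \<subseteq> carrier G \<times> carrier G"
    and lin: "strict_linear_order_on (carrier G) r"
    and inv: "\<forall>f\<in>carrier G. \<forall>g\<in>carrier G. \<forall>h\<in>carrier G. (g, h) \<in> r \<longrightarrow> (f \<otimes> g, f \<otimes> h) \<in> r"
    unfolding left_orderable_def by blast
  define D where "D = proper_lower_sets G r"
  interpret chain_action G D "l_coset G"
    unfolding D_def using inv by (intro chain_action_lower_sets[OF r lin]) blast
  obtain p q where pq: "(p, q) \<in> r"
    using nontriv lin unfolding strict_linear_order_on_def total_on_def
    by (metis one_closed insertI1 singletonD subsetI subset_antisym)
  \<comment> \<open>A nontrivial group has a pair p < q; the elements below q form a lower set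
    containing p but not q.\<close>
  have "{z. (z, q) \<in> r} \<in> D"
    using pq r lin unfolding D_def proper_lower_sets_def strict_linear_order_on_def
    by (auto simp: irrefl_def dest: transD)
  then have ne: "D \<noteq> {}" by blast
  define U where "U = (inv a \<otimes> b) [^] m"
  have [simp]: "U \<in> carrier G" by (simp add: U_def)
  have pow2: "x [^] (2::nat) = x \<otimes> x" "x [^] (-2::int) = inv x \<otimes> inv x"
    if "x \<in> carrier G" for x
    using that int_pow_neg_int[of x 2] by (simp_all add: numeral_2_eq_2 inv_mult_group)
  \<comment> \<open>This turns the powers of \<open>inv b \<otimes> a\<close> and
    \<open>inv c \<otimes> d\<close> in the second and fourth relators into \<open>inv U\<close> and
    \<open>inv V\<close>.\<close>
  have pow_inv: "(inv y \<otimes> x) [^] j = inv ((inv x \<otimes> y) [^] j)"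
    if "x \<in> carrier G" "y \<in> carrier G" for x y and j :: nat
    using that by (simp add: nat_pow_inv[symmetric] inv_mult_group)
  define V where "V = (inv d \<otimes> c) [^] k"
  have [simp]: "V \<in> carrier G" by (simp add: V_def)
  have "d = a \<otimes> a \<otimes> U"
  proof -
    have "(U \<otimes> inv d) \<otimes> (a \<otimes> a) = \<one>" using r1 by (simp add: pow2 U_def)
    then have "U \<otimes> inv d = inv (a \<otimes> a)" by (intro inv_equality[symmetric]) simp_all
    then have "U = inv (a \<otimes> a) \<otimes> d" by (subst (asm) inv_solve_right') simp_all
    then show ?thesis by (subst (asm) inv_solve_left) simp_all
  qed
  moreover have "c = b \<otimes> b \<otimes> U"
  proof -
    have "(inv (b \<otimes> b) \<otimes> c) \<otimes> inv U = \<one>"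
      using r2 pow_inv[of a b m] by (simp add: pow2 U_def inv_mult_group)
    then have "inv (b \<otimes> b) \<otimes> c = U" by (subst (asm) inv_solve_right') simp_all
    then show ?thesis by (subst (asm) inv_solve_left') simp_all
  qed
  moreover have "V = c \<otimes> c \<otimes> inv b \<otimes> c"
  proof -
    have "V \<otimes> (inv c \<otimes> b \<otimes> (inv c \<otimes> inv c)) = \<one>"
      using r3 by (simp add: pow2 V_def m_assoc)
    then have "V = inv (inv c \<otimes> b \<otimes> (inv c \<otimes> inv c))"
      by (intro inv_equality[symmetric]) simp_all
    then show ?thesis by (simp add: inv_mult_group m_assoc)
  qed
  moreover have "V = d \<otimes> d \<otimes> inv a \<otimes> d"
  proof -
    have "(d \<otimes> d \<otimes> inv a \<otimes> d) \<otimes> inv V = \<one>"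
      using r4 pow_inv[of d c k] by (simp add: pow2 V_def)
    then show ?thesis by (subst (asm) inv_solve_right') simp_all
  qed
  ultimately obtain S where S: "S \<in> D"
    and fixed: "a <# S = S" "b <# S = S" "c <# S = S" "d <# S = S"
    using kanenobu_fixed_point[of a b c d U m k] ne abcd U_def V_def by metis
  \<comment> \<open>The stabilizer of \<open>S\<close> is a subgroup containing the four generators,
    so \<open>gen\<close> makes it everything.\<close>
  have "subgroup {g \<in> carrier G. g <# S = S} G"
  proof (rule subgroupI)
    fix g assume "g \<in> {g \<in> carrier G. g <# S = S}"
    then show "inv g \<in> {g \<in> carrier G. g <# S = S}"
      using S act_inv_act[of g S] by auto
  qed (use S in \<open>auto simp: act_mult\<close>)
  then have all: "g <# S = S" if "g \<in> carrier G" for g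
    using gen[of "{g \<in> carrier G. g <# S = S}"] fixed that by auto
  have "S \<subset> carrier G" "S \<noteq> {}" using S by (auto simp: D_def proper_lower_sets_def)
  then obtain x y where x: "x \<in> S" "x \<in> carrier G" and y: "y \<in> carrier G" "y \<notin> S" by blast
  have "(y \<otimes> inv x) \<otimes> x \<in> (y \<otimes> inv x) <# S" using x by (auto simp: l_coset_def)
  then show False using all[of "y \<otimes> inv x"] x y by (simp add: m_assoc)
qed

section \<open>Passage to the presented group\<close>

text \<open>Word induction, phrased without words: the first letter of a representative is peeled
  off. It serves to show that the images of the generators generate the quotient.\<close>

lemma free_group_induct [consumes 1, case_names one gen inv_gen]:
  assumes "X \<in> carrier free_group"
    and "P \<one>\<^bsub>free_group\<^esub>"
    and "\<And>x Y. Y \<in> carrier free_group \<Longrightarrow> P Y \<Longrightarrow> P (free_gen x \<otimes>\<^bsub>free_group\<^esub> Y)"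
    and "\<And>x Y. Y \<in> carrier free_group \<Longrightarrow> P Y \<Longrightarrow>
      P (inv\<^bsub>free_group\<^esub> free_gen x \<otimes>\<^bsub>free_group\<^esub> Y)"
  shows "P X"
proof -
  interpret F: group free_group by (rule group_free_group)
  have inv_gen: "inv\<^bsub>free_group\<^esub> free_gen x = free_class [(x, False)]" for x :: 'a
    using free_eq.cancel[of "[]" x False "[]"]
    by (intro F.inv_equality)
       (auto simp: free_gen_def carrier_free_group mult_free_group one_free_group free_class_eq_iff)
  have "P (free_class w)" for w
  proof (induction w)
    case Nil
    then show ?case using assms(2) by (simp add: one_free_group)
  next
    case (Cons p w)
    obtain x s where p: "p = (x, s)" by (cases p)
    show ?case
      using Cons assms(3)[of "free_class w" x] assms(4)[of "free_class w" x] p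
      by (cases s) (simp_all add: carrier_free_group inv_gen, simp_all add: free_gen_def mult_free_group)
  qed
  then show ?thesis using assms(1) by (auto simp: carrier_free_group)
qed

theorem mainTheorem1:
  fixes n :: nat
  shows "\<not> left_orderable (kanenobu_group n)"
proof -
  define N where "N = normal_closure free_group (kanenobu_relators n)"
  define \<phi> where "\<phi> = (\<lambda>X. N #>\<^bsub>free_group\<^esub> X)"
  interpret F: group "free_group :: generator word set monoid" by (rule group_free_group)
  interpret G: group "kanenobu_group n" by (rule group_kanenobu_group)
  interpret N: normal N free_group
    unfolding N_def by (rule F.normal_normal_closure[OF kanenobu_relators_closed])
  have G: "kanenobu_group n = free_group Mod N"
    by (simp add: kanenobu_group_def presented_group_def N_def)
  interpret \<phi>: group_hom free_group "kanenobu_group n" \<phi>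
    by unfold_locales (simp add: G \<phi>_def N.r_coset_hom_Mod)
  have rel: "\<phi> x = \<one>\<^bsub>kanenobu_group n\<^esub>" if "x \<in> kanenobu_relators n" for x
  proof -
    have "x \<in> N" using that subset_normal_closure[of "kanenobu_relators n" free_group] by (auto simp: N_def)
    then show ?thesis
      by (simp add: G \<phi>_def FactGroup_def F.coset_join2 N.subgroup_axioms)
  qed
  have carrier: "carrier (kanenobu_group n) = \<phi> ` carrier free_group"
    by (auto simp: G \<phi>_def FactGroup_def RCOSETS_def)
  have gen: "carrier (kanenobu_group n) \<subseteq> H"
    if H: "subgroup H (kanenobu_group n)" and gens: "\<phi> (free_gen Gen_a) \<in> H"
      "\<phi> (free_gen Gen_b) \<in> H" "\<phi> (free_gen Gen_c) \<in> H" "\<phi> (free_gen Gen_d) \<in> H" for H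
  proof -
    interpret H: subgroup H "kanenobu_group n" by (rule H)
    have x: "\<phi> (free_gen x) \<in> H" for x using gens by (cases x) simp_all
    have "\<phi> X \<in> H" if "X \<in> carrier free_group" for X
      using that by (induction rule: free_group_induct) (simp_all add: x free_gen_closed)
    then show ?thesis using carrier by auto
  qed
  \<comment> \<open>In this bounded form \<open>ball_simps\<close> splits the explicit set of
    relators into four equations, which the homomorphism rules then turn into relations between the
    images of the generators.\<close>
  have "\<forall>x\<in>kanenobu_relators n. \<phi> x = \<one>\<^bsub>kanenobu_group n\<^esub>" using rel by blast
  note rels = this[unfolded kanenobu_relators_def Let_def ball_simps]
  have closed: "\<phi> (free_gen x) \<in> carrier (kanenobu_group n)" for x
    by (simp add: free_gen_closed)
  show ?thesis
  proof (rule G.not_left_orderable_if_kanenobu_relations[where m = "10 * n" and k = "10 * n + 3"])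
    show "carrier (kanenobu_group n) \<subseteq> H"
      if "subgroup H (kanenobu_group n)" "{\<phi> (free_gen Gen_a), \<phi> (free_gen Gen_b), \<phi> (free_gen Gen_c), \<phi> (free_gen Gen_d)} \<subseteq> H" for H
      using gen that by simp
  qed (use rels closed in \<open>simp_all add: free_gen_closed \<phi>.hom_nat_pow \<phi>.hom_int_pow\<close>)
qed

end
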